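(* Let the intensities be $$\lambda^{(m)}(t)=\mu^{(m)}+\sum_{l=1}^MK_{l,m}\sum_{i:\,t_{l,i}\le t-1}Y^{(l)}_{t_{l,i}}\beta_{l,m}(1-\beta_{l,m})^{t-t_{l,i}-1}.$$ For $l,m\in\{1,\dots,M\}$ define $R^3(1,l,m):=0$ and $$R^3(t+1,l,m)=(1-\beta_{l,m})R^3(t,l,m)+Y_t^{(l)}\beta_{l,m},\qquad t=1,2,\dots,N_\delta-1.$$ Then for every $m\in\{1,\dots,M\}$ and every $t\in\{1,\dots,N_\delta\}$, $$\lambda^{(m)}(t)=\mu^{(m)}+\sum_{l=1}^MK_{l,m}R^3(t,l,m).$$
   Context: Fix integers $M\ge1$ (number of dimensions) and $N_\delta\ge1$ (number of discrete time steps). For $l\in\{1,\dots,M\}$ and $t\in\{1,\dots,N_\delta\}$, $Y_t^{(l)}\in\{0,1,2,\dots\}$ is the number of events in dimension $l$ at time step $t$. The set of arrival times in dimension $l$ is $\{t: Y^{(l)}_t>0\}=\{t_{l,1}<\dots<t_{l,N_l}\}$. The parameters satisfy $\mu^{(m)}>0$, $K_{l,m}>0$, $\beta_{l,m}\in(0,1)$. *)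

theory Defs
  imports Complex_Main
begin

text \<open>
  Dimensions are indexed by \<open>{1..M}\<close> and time steps by \<open>{1..N}\<close>. The count in dimension \<open>l\<close> at
  step \<open>t\<close> is \<open>Y l t\<close>; its values outside this index range are never used.
\<close>

definition arrivals :: "nat \<Rightarrow> (nat \<Rightarrow> nat \<Rightarrow> nat) \<Rightarrow> nat \<Rightarrow> nat set" where
  "arrivals N Y l = {t \<in> {1..N}. Y l t > 0}"

definition num_arrivals :: "nat \<Rightarrow> (nat \<Rightarrow> nat \<Rightarrow> nat) \<Rightarrow> nat \<Rightarrow> nat" where
  "num_arrivals N Y l = card (arrivals N Y l)"

text \<open>
  The increasing enumeration of the arrival times, with the index \<open>i\<close> starting at 1;
  meaningful for \<open>1 \<le> i \<le> num_arrivals N Y l\<close>.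
\<close>

definition arrival_time :: "nat \<Rightarrow> (nat \<Rightarrow> nat \<Rightarrow> nat) \<Rightarrow> nat \<Rightarrow> nat \<Rightarrow> nat" where
  "arrival_time N Y l i = sorted_list_of_set (arrivals N Y l) ! (i - 1)"

text \<open>
  For \<open>t \<ge> 1\<close>, the condition on \<open>i\<close> in the inner sum means that no natural-number subtraction
  below is truncated.
\<close>

definition intensity ::
  "nat \<Rightarrow> nat \<Rightarrow> (nat \<Rightarrow> real) \<Rightarrow> (nat \<Rightarrow> nat \<Rightarrow> real) \<Rightarrow> (nat \<Rightarrow> nat \<Rightarrow> real) \<Rightarrow>
    (nat \<Rightarrow> nat \<Rightarrow> nat) \<Rightarrow> nat \<Rightarrow> nat \<Rightarrow> real" where
  "intensity M N \<mu> K \<beta> Y m t =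
     \<mu> m + (\<Sum>l = 1..M. K l m *
       (\<Sum>i \<in> {i \<in> {1..num_arrivals N Y l}. arrival_time N Y l i \<le> t - 1}.
          real (Y l (arrival_time N Y l i)) * \<beta> l m *
          (1 - \<beta> l m) ^ (t - arrival_time N Y l i - 1)))"

end

theory Submission
  imports Defs
begin

text \<open>
  Summing over the arrivals before \<open>t\<close> is the same as summing over all time steps before \<open>t\<close>,
  because the steps without an event contribute zero. The full sum
  \<open>\<Sum>s = 1..<t. Y s * b * (1 - b) ^ (t - s - 1)\<close> solves the recursion for \<open>R3\<close>: passing from
  \<open>t\<close> to \<open>t + 1\<close> multiplies every old term by \<open>1 - b\<close> and adds the new term at \<open>s = t\<close>.
\<close>

text \<open>The sorted list of a finite set has no repetitions, so its indexing map is a bijection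
  onto the set. List positions count from 0 but arrivals from 1; the shift \<open>i - 1\<close>,
  with inverse \<open>Suc\<close>, bridges the two.\<close>

lemma bij_betw_arrival_time:
  "bij_betw (arrival_time N Y l) {1..num_arrivals N Y l} (arrivals N Y l)"
proof -
  have fin: "finite (arrivals N Y l)"
    by (simp add: arrivals_def)
  have "bij_betw (\<lambda>i. i - 1) {1..num_arrivals N Y l} {..<num_arrivals N Y l}"
    by (rule bij_betw_byWitness[where f' = Suc]) auto
  moreover have "bij_betw ((!) (sorted_list_of_set (arrivals N Y l)))
      {..<num_arrivals N Y l} (arrivals N Y l)"
    using fin by (intro bij_betw_nth) (simp_all add: num_arrivals_def)
  ultimately have "bij_betw ((!) (sorted_list_of_set (arrivals N Y l)) \<circ> (\<lambda>i. i - 1))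
      {1..num_arrivals N Y l} (arrivals N Y l)"
    by (rule bij_betw_trans)
  then show ?thesis
    by (simp add: arrival_time_def[abs_def] comp_def)
qed

lemma sum_arrival_time:
  fixes f :: "nat \<Rightarrow> 'a::comm_monoid_add"
  assumes "t \<in> {1..N}" and zero: "\<And>s. Y l s = 0 \<Longrightarrow> f s = 0"
  shows "(\<Sum>i \<in> {i \<in> {1..num_arrivals N Y l}. arrival_time N Y l i \<le> t - 1}.
            f (arrival_time N Y l i)) = (\<Sum>s = 1..<t. f s)"
proof -
  \<comment> \<open>Once \<open>arrivals N Y l\<close> is written as the image of the whole index
    range, this is plain set algebra.\<close>
  have "arrival_time N Y l ` {i \<in> {1..num_arrivals N Y l}. arrival_time N Y l i \<le> t - 1} =
      {s \<in> arrivals N Y l. s \<le> t - 1}"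
    unfolding bij_betw_imp_surj_on[OF bij_betw_arrival_time, symmetric] by blast
  then have "bij_betw (arrival_time N Y l)
      {i \<in> {1..num_arrivals N Y l}. arrival_time N Y l i \<le> t - 1}
      {s \<in> arrivals N Y l. s \<le> t - 1}"
    by (intro bij_betw_subset[OF bij_betw_arrival_time]) blast+
  then have "(\<Sum>i \<in> {i \<in> {1..num_arrivals N Y l}. arrival_time N Y l i \<le> t - 1}.
            f (arrival_time N Y l i)) = (\<Sum>s \<in> {s \<in> arrivals N Y l. s \<le> t - 1}. f s)"
    by (rule sum.reindex_bij_betw)
  \<comment> \<open>As \<open>t \<le> N\<close>, every \<open>s < t\<close> in the range that is not
    an arrival has \<open>Y l s = 0\<close>.\<close>
  also have "\<dots> = (\<Sum>s = 1..<t. f s)"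
    using assms(1) by (intro sum.mono_neutral_left) (auto simp: arrivals_def intro!: zero)
  finally show ?thesis .
qed

text \<open>Induction from 1, where the sum is empty. In the step, \<open>Suc t \<le> N\<close> puts
  \<open>t\<close> in the range where the recursion is assumed.\<close>

lemma linear_recurrence_solution:
  fixes R y :: "nat \<Rightarrow> 'a::comm_semiring_1"
  assumes "R 1 = 0"
    and "\<And>t. t \<in> {1..N - 1} \<Longrightarrow> R (t + 1) = q * R t + y t"
    and "1 \<le> t" "t \<le> N"
  shows "R t = (\<Sum>s = 1..<t. y s * q ^ (t - s - 1))"
  using assms(3,4)
proof (induction t rule: dec_induct)
  case base
  show ?case using assms(1) by simp
next
  case (step t)
  have "R (Suc t) = q * (\<Sum>s = 1..<t. y s * q ^ (t - s - 1)) + y t"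
    using assms(2)[of t] step by simp
  also have "q * (\<Sum>s = 1..<t. y s * q ^ (t - s - 1)) = (\<Sum>s = 1..<t. y s * q ^ (t - s))"
    unfolding sum_distrib_left
  proof (intro sum.cong refl)
    fix s assume "s \<in> {1..<t}"
    \<comment> \<open>Since \<open>s < t\<close>, the subtraction is not truncated, and the factor
      \<open>q\<close> raises the exponent by exactly one.\<close>
    then have "t - s = Suc (t - s - 1)" by auto
    then have "q ^ (t - s) = q * q ^ (t - s - 1)" by (metis power_Suc)
    then show "q * (y s * q ^ (t - s - 1)) = y s * q ^ (t - s)"
      by (simp add: mult.left_commute)
  qed
  \<comment> \<open>The summand at \<open>s = t\<close> has exponent 0, so it is
    \<open>y t\<close>.\<close>
  also have "\<dots> + y t = (\<Sum>s = 1..<Suc t. y s * q ^ (Suc t - s - 1))"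
    using step by simp
  finally show ?case .
qed

theorem lemmaC1:
  fixes M N :: nat
    and Y :: "nat \<Rightarrow> nat \<Rightarrow> nat"
    and \<mu> :: "nat \<Rightarrow> real"
    and K \<beta> :: "nat \<Rightarrow> nat \<Rightarrow> real"
    and R3 :: "nat \<Rightarrow> nat \<Rightarrow> nat \<Rightarrow> real"
  assumes "M \<ge> 1" and "N \<ge> 1"
    and "\<And>m. m \<in> {1..M} \<Longrightarrow> \<mu> m > 0"
    and "\<And>l m. l \<in> {1..M} \<Longrightarrow> m \<in> {1..M} \<Longrightarrow> K l m > 0"
    and "\<And>l m. l \<in> {1..M} \<Longrightarrow> m \<in> {1..M} \<Longrightarrow> \<beta> l m \<in> {0<..<1}"
    and "\<And>l m. l \<in> {1..M} \<Longrightarrow> m \<in> {1..M} \<Longrightarrow> R3 1 l m = 0"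
    and "\<And>l m t. l \<in> {1..M} \<Longrightarrow> m \<in> {1..M} \<Longrightarrow> t \<in> {1..N - 1} \<Longrightarrow>
           R3 (t + 1) l m = (1 - \<beta> l m) * R3 t l m + real (Y l t) * \<beta> l m"
  shows "\<forall>m \<in> {1..M}. \<forall>t \<in> {1..N}.
           intensity M N \<mu> K \<beta> Y m t = \<mu> m + (\<Sum>l = 1..M. K l m * R3 t l m)"
proof (intro ballI)
  fix m t assume m: "m \<in> {1..M}" and t: "t \<in> {1..N}"
  have "(\<Sum>i \<in> {i \<in> {1..num_arrivals N Y l}. arrival_time N Y l i \<le> t - 1}.
          real (Y l (arrival_time N Y l i)) * \<beta> l m *
          (1 - \<beta> l m) ^ (t - arrival_time N Y l i - 1)) = R3 t l m"
    if l: "l \<in> {1..M}" for l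
  proof -
    \<comment> \<open>For fixed \<open>l\<close> and \<open>m\<close>, take
      \<open>q = 1 - \<beta> l m\<close> and
      \<open>y s = real (Y l s) * \<beta> l m\<close>.\<close>
    have "R3 t l m = (\<Sum>s = 1..<t. real (Y l s) * \<beta> l m * (1 - \<beta> l m) ^ (t - s - 1))"
      using t assms(6)[OF l m] assms(7)[OF l m]
      by (intro linear_recurrence_solution[where N = N and R = "\<lambda>t. R3 t l m"]) auto
    then show ?thesis
      using sum_arrival_time[OF t, of Y l
        "\<lambda>s. real (Y l s) * \<beta> l m * (1 - \<beta> l m) ^ (t - s - 1)"] by simp
  qed
  then show "intensity M N \<mu> K \<beta> Y m t = \<mu> m + (\<Sum>l = 1..M. K l m * R3 t l m)"
    unfolding intensity_def by simp
qed

end
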